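(* Let $N$ be a positive integer. If $A\in SL_2(\mathbb{R})$ satisfies $A\Gamma_1(N)A^{-1}\subseteq\Gamma_0(N)$, then $A\in\Gamma_0^{*,s_N}(N)$.
   Context: For a positive integer $M$, write uniquely $M=s_M^2t_M$ with $s_M,t_M$ positive integers and $t_M$ square-free. A positive divisor $\mu$ of $N$ is exact if $\gcd(\mu,N/\mu)=1$. $\Gamma_0^{*,s_N}(N)$ is the set of $A\in SL_2(\mathbb{R})$ admitting a presentation $A=\begin{pmatrix} a\sqrt{\mu} & b/\sqrt{\mu}\\ c\frac{N}{\mu}\sqrt{\mu} & d\sqrt{\mu}\end{pmatrix}$ with $\mu$ an exact divisor of $N$, $a,d\in\frac{1}{s_\mu}\mathbb{Z}$ and $b,c\in\frac{1}{s_{N/\mu}}\mathbb{Z}$. $\Gamma_0(N)$ is the group of matrices in $SL_2(\mathbb{Z})$ with lower left entry divisible by $N$; $\Gamma_1(N)$ is its subgroup of matrices whose diagonal entries are congruent to $1$ modulo $N$. *)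

theory Defs
  imports "HOL-Analysis.Analysis" "HOL-Computational_Algebra.Squarefree" "HOL-Number_Theory.Cong"
begin

definition SL2R :: "(real^2^2) set" where
  "SL2R = {A. det A = 1}"

definition Gamma0 :: "nat \<Rightarrow> (int^2^2) set" where
  "Gamma0 N = {B. det B = 1 \<and> int N dvd B $ 2 $ 1}"

definition Gamma1 :: "nat \<Rightarrow> (int^2^2) set" where
  "Gamma1 N = {B \<in> Gamma0 N. [B $ 1 $ 1 = 1] (mod int N) \<and> [B $ 2 $ 2 = 1] (mod int N)}"

abbreviation real_mat :: "int^2^2 \<Rightarrow> real^2^2" where
  "real_mat \<equiv> map_matrix real_of_int"

text \<open>
  \<^term>\<open>frac_ints s\<close> is the subgroup (1/s)Z of the reals, used only for s > 0.
\<close>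

definition frac_ints :: "nat \<Rightarrow> real set" where
  "frac_ints s = range (\<lambda>k::int. real_of_int k / real s)"

definition exact_divisor :: "nat \<Rightarrow> nat \<Rightarrow> bool" where
  "exact_divisor \<mu> N \<longleftrightarrow> \<mu> > 0 \<and> \<mu> dvd N \<and> coprime \<mu> (N div \<mu>)"

text \<open>
  In the unique decomposition of M > 0 as s^2 t with t square-free, s is
  \<^term>\<open>square_part M\<close> and t is \<^term>\<open>squarefree_part M\<close>
  (see \<open>squarefree_decompose\<close> and \<open>squarefree_squarefree_part\<close>).
  The superscript s_N of the group is determined by N, so it is not a separate argument below.
\<close>

definition Gamma0_star :: "nat \<Rightarrow> (real^2^2) set" where
  "Gamma0_star N = {A \<in> SL2R. \<exists>\<mu> a b c d. exact_divisor \<mu> N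
     \<and> a \<in> frac_ints (square_part \<mu>) \<and> d \<in> frac_ints (square_part \<mu>)
     \<and> b \<in> frac_ints (square_part (N div \<mu>)) \<and> c \<in> frac_ints (square_part (N div \<mu>))
     \<and> A = vector [vector [a * sqrt (real \<mu>), b / sqrt (real \<mu>)],
                   vector [c * real (N div \<mu>) * sqrt (real \<mu>), d * sqrt (real \<mu>)]]}"

end

theory Submission
  imports Defs "HOL-Computational_Algebra.Nth_Powers"
begin

text \<open>
  Write \<open>A = (\<alpha>, \<beta>; \<gamma>, \<delta>)\<close>. Conjugating \<open>(1, 1; 0, 1)\<close>, \<open>(1, 0; N, 1)\<close> and their product shows
  that \<open>a = \<alpha>\<^sup>2\<close>, \<open>b = N \<beta>\<^sup>2\<close>, \<open>c = \<gamma>\<^sup>2 / N\<close>, \<open>d = \<delta>\<^sup>2\<close> are natural numbers for which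
  \<open>N a b\<close>, \<open>N a c\<close>, \<open>N b d\<close>, \<open>N c d\<close> and \<open>a d\<close> are squares. Moreover \<open>\<alpha> \<delta>\<close> and
  \<open>\<beta> \<gamma> = \<alpha> \<delta> - 1\<close> are coprime integers, so \<open>a d\<close> and \<open>b c\<close> are coprime. Let \<open>\<mu>\<close> collect the
  full prime powers of \<open>N\<close> at the primes that divide both \<open>a\<close> and \<open>d\<close>. Comparing parities of
  valuations, \<open>a\<close> and \<open>d\<close> are squares times the squarefree part of \<open>\<mu>\<close>, while \<open>b\<close> and \<open>c\<close> are
  squares times the squarefree part of \<open>N / \<mu>\<close>.
\<close>

section \<open>Squarefree parts and exact divisors of natural numbers\<close>

lemma squarefree_part_mult_squareI:
  fixes m n :: nat
  assumes "\<And>p. prime p \<Longrightarrow> n \<noteq> 0 \<Longrightarrow> even (multiplicity p m + multiplicity p n)"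
  shows "\<exists>k. n = squarefree_part m * k\<^sup>2"
proof (cases "n = 0")
  case False
  have "squarefree_part n = squarefree_part m"
  proof (rule multiplicity_eq_nat)
    fix p :: nat
    assume "prime p"
    then show "multiplicity p (squarefree_part n) = multiplicity p (squarefree_part m)"
      using assms[of p] False by (simp add: prime_multiplicity_squarefree_part) presburger
  qed (auto intro!: Nat.gr0I)
  then show ?thesis
    by (metis squarefree_decompose)
qed auto

lemma even_multiplicity_square_mult:
  fixes x y :: nat
  assumes "is_nth_power 2 (x * y)" "prime p" "x \<noteq> 0" "y \<noteq> 0"
  shows "even (multiplicity p x + multiplicity p y)"
  using assms by (auto simp: is_nth_power_conv_multiplicity_nat prime_elem_multiplicity_mult_distrib)

text \<open>Splitting the prime factorization of \<open>n\<close> according to \<open>P\<close>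
  gives two factors without common primes.\<close>

lemma exists_unitary_divisor:
  fixes n :: nat
  assumes "n > 0"
  obtains u where "exact_divisor u n"
    "\<And>p. prime p \<Longrightarrow> multiplicity p u = (if P p then multiplicity p n else 0)"
    "\<And>p. prime p \<Longrightarrow> multiplicity p (n div u) = (if P p then 0 else multiplicity p n)"
proof -
  define S where "S = {p \<in> prime_factors n. P p}"
  define T where "T = {p \<in> prime_factors n. \<not> P p}"
  define u where "u = (\<Prod>p\<in>S. p ^ multiplicity p n)"
  define v where "v = (\<Prod>p\<in>T. p ^ multiplicity p n)"
  have fin: "finite S" "finite T" and ST: "S \<inter> T = {}" "S \<union> T = prime_factors n"
    by (auto simp: S_def T_def)
  have pr: "prime p" if "p \<in> S \<union> T" for p
    using that by (auto simp: ST)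
  have n: "n = u * v"
    unfolding u_def v_def prod.union_disjoint[OF fin ST(1), symmetric] ST(2)
    using assms by (simp add: prod_prime_factors)
  have pos: "u > 0" "v > 0"
    using n assms by auto
  have "coprime u v"
    unfolding u_def v_def
  proof (intro prod_coprime_left prod_coprime_right)
    fix p q assume "p \<in> S" "q \<in> T"
    then have "coprime p q"
      using ST(1) pr by (intro primes_coprime) auto
    then show "coprime (p ^ multiplicity p n) (q ^ multiplicity q n)"
      by simp
  qed
  then have "exact_divisor u n"
    using n pos by (auto simp: exact_divisor_def)
  moreover have "multiplicity p u = (if P p then multiplicity p n else 0)"
      "multiplicity p (n div u) = (if P p then 0 else multiplicity p n)" if "prime p" for p
  proof -
    have "multiplicity p u = (if p \<in> S then multiplicity p n else 0)"
      unfolding u_def using fin pr that by (intro multiplicity_prod_prime_powers) auto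
    then show "multiplicity p u = (if P p then multiplicity p n else 0)"
      using that by (auto simp: S_def prime_factors_multiplicity)
    have "multiplicity p v = (if p \<in> T then multiplicity p n else 0)"
      unfolding v_def using fin pr that by (intro multiplicity_prod_prime_powers) auto
    then show "multiplicity p (n div u) = (if P p then 0 else multiplicity p n)"
      using that n pos by (auto simp: T_def prime_factors_multiplicity)
  qed
  ultimately show ?thesis
    using that by blast
qed

text \<open>At each prime, coprimality clears either \<open>a * d\<close> or \<open>b * c\<close>. A
  factor prime to \<open>p\<close> drops out of its square product with \<open>N\<close>, which
  leaves the parity of the other factor equal to that of \<open>N\<close>.\<close>

lemma exact_divisor_of_square_products:
  fixes N a b c d :: nat
  assumes "N > 0"
    and Nab: "is_nth_power 2 (N * a * b)" and Nac: "is_nth_power 2 (N * a * c)"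
    and Nbd: "is_nth_power 2 (N * b * d)" and Ncd: "is_nth_power 2 (N * c * d)"
    and ad: "is_nth_power 2 (a * d)" and cop: "coprime (a * d) (b * c)"
  obtains u k l i j where "exact_divisor u N"
    "a = squarefree_part u * k\<^sup>2" "d = squarefree_part u * l\<^sup>2"
    "b = squarefree_part (N div u) * i\<^sup>2" "c = squarefree_part (N div u) * j\<^sup>2"
proof -
  obtain u where u: "exact_divisor u N"
    and mu: "\<And>p. prime p \<Longrightarrow> multiplicity p u = (if p dvd a \<and> p dvd d then multiplicity p N else 0)"
    and mv: "\<And>p. prime p \<Longrightarrow>
      multiplicity p (N div u) = (if p dvd a \<and> p dvd d then 0 else multiplicity p N)"
    using exists_unitary_divisor[OF \<open>N > 0\<close>, of "\<lambda>p. p dvd a \<and> p dvd d"] by blast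
  have disj: "\<not> p dvd b \<and> \<not> p dvd c \<or> \<not> p dvd a \<and> \<not> p dvd d" if "prime p" for p
    using cop that not_prime_unit by (meson coprime_common_divisor dvd_mult dvd_mult2)
  have triple: "even (multiplicity p N + multiplicity p x)"
    if "is_nth_power 2 (N * x * y)" "prime p" "x \<noteq> 0" "\<not> p dvd y" for p x y
  proof -
    have "y \<noteq> 0"
      using that by (intro notI) simp
    then have "even (multiplicity p (N * x) + multiplicity p y)"
      using that \<open>N > 0\<close> by (intro even_multiplicity_square_mult) auto
    then show ?thesis
      using that \<open>N > 0\<close>
      by (simp add: prime_elem_multiplicity_mult_distrib not_dvd_imp_multiplicity_0)
  qed
  \<comment> \<open>Stating this for an unordered pair lets one argument serve both \<open>a\<close>
    and \<open>d\<close>.\<close>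
  have left: "\<exists>k. x = squarefree_part u * k\<^sup>2"
    if "{x, y} = {a, d}" "is_nth_power 2 (N * x * b)" "is_nth_power 2 (x * y)" for x y
  proof (rule squarefree_part_mult_squareI)
    fix p :: nat
    assume p: "prime p" "x \<noteq> 0"
    have mu': "multiplicity p u = (if p dvd x \<and> p dvd y then multiplicity p N else 0)"
      using mu[OF p(1)] that(1) by (auto simp: doubleton_eq_iff)
    show "even (multiplicity p u + multiplicity p x)"
    proof (cases "p dvd x")
      case True
      have "\<not> p dvd b"
        using disj[OF p(1)] True that(1) by (auto simp: doubleton_eq_iff)
      then have "even (multiplicity p N + multiplicity p x)"
        using triple that p by blast
      \<comment> \<open>In this case \<open>u\<close> has valuation 0 at \<open>p\<close>, and the
        square \<open>x * y\<close> supplies the parity of \<open>x\<close> alone.\<close>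
      moreover have "even (multiplicity p x)" if "\<not> p dvd y"
      proof -
        have "y \<noteq> 0"
          using that by (intro notI) simp
        then show ?thesis
          using even_multiplicity_square_mult[OF \<open>is_nth_power 2 (x * y)\<close> p] that
          by (simp add: not_dvd_imp_multiplicity_0)
      qed
      ultimately show ?thesis
        using True by (simp add: mu')
    qed (simp add: mu' not_dvd_imp_multiplicity_0)
  qed
  have right: "\<exists>k. x = squarefree_part (N div u) * k\<^sup>2"
    if "x = b \<or> x = c" "is_nth_power 2 (N * x * a)" "is_nth_power 2 (N * x * d)" for x
  proof (rule squarefree_part_mult_squareI)
    fix p :: nat
    assume p: "prime p" "x \<noteq> 0"
    show "even (multiplicity p (N div u) + multiplicity p x)"
    proof (cases "p dvd a \<and> p dvd d")
      case True
      then have "\<not> p dvd x"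
        using disj[OF p(1)] that(1) by auto
      then show ?thesis
        using True p by (simp add: mv not_dvd_imp_multiplicity_0)
    next
      case False
      \<comment> \<open>One of \<open>a\<close>, \<open>d\<close> is prime to \<open>p\<close> and
        serves as the cofactor.\<close>
      then have "even (multiplicity p N + multiplicity p x)"
        using triple that p by blast
      then show ?thesis
        using False p by (simp only: mv if_False)
    qed
  qed
  have flip: "N * d * b = N * b * d" "d * a = a * d" "N * b * a = N * a * b" "N * c * a = N * a * c"
    by simp_all
  obtain k where "a = squarefree_part u * k\<^sup>2"
    using left[of a d] Nab ad by blast
  moreover obtain l where "d = squarefree_part u * l\<^sup>2"
    using left[of d a, unfolded flip] Nbd ad by blast
  moreover obtain i where "b = squarefree_part (N div u) * i\<^sup>2"
    using right[of b, unfolded flip] Nab Nbd by blast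
  moreover obtain j where "c = squarefree_part (N div u) * j\<^sup>2"
    using right[of c, unfolded flip] Nac Ncd by blast
  ultimately show ?thesis
    using that u by blast
qed

section \<open>Integrality criteria for real numbers\<close>

text \<open>The square fixes \<open>x * real s\<close> up to sign, and the numerator may have either
  sign.\<close>

lemma frac_intsI:
  assumes "s > 0" "(x * real s)\<^sup>2 = (real k)\<^sup>2"
  shows "x \<in> frac_ints s"
proof -
  have "x * real s = real_of_int (int k) \<or> x * real s = real_of_int (- int k)"
    using assms(2) by (simp add: power2_eq_iff)
  then obtain z :: int where "x * real s = real_of_int z"
    by blast
  then have "x = real_of_int z / real s"
    using assms(1) by (simp add: field_simps)
  then show ?thesis
    by (auto simp: frac_ints_def)
qed

lemma is_square_natI:
  assumes "x \<in> \<int>" "real n = x\<^sup>2"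
  shows "is_nth_power 2 n"
proof -
  obtain z where "x = real_of_int z"
    using assms(1) by (auto elim: Ints_cases)
  then have "real n = real ((nat \<bar>z\<bar>)\<^sup>2)"
    using assms(2) by simp
  then show ?thesis
    by (metis is_nth_powerI of_nat_eq_iff)
qed

text \<open>A rational number with integral square is integral: \<open>N^2\<close> divides
  \<open>z^2\<close>, hence \<open>N\<close> divides \<open>z\<close>.\<close>

lemma Ints_if_square_and_multiple_Ints:
  fixes x :: real
  assumes "N > 0" "real N * x \<in> \<int>" "x\<^sup>2 \<in> \<int>"
  shows "x \<in> \<int>"
proof -
  obtain z w where z: "real N * x = of_int z" and w: "x\<^sup>2 = of_int w"
    using assms by (auto elim!: Ints_cases)
  have "real_of_int (z\<^sup>2) = (real N * x)\<^sup>2"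
    by (simp add: z)
  also have "\<dots> = real_of_int ((int N)\<^sup>2 * w)"
    by (simp add: power_mult_distrib w)
  finally have "(int N)\<^sup>2 dvd z\<^sup>2"
    by (simp only: of_int_eq_iff dvd_triv_left)
  then obtain y where "z = int N * y"
    by (auto simp: pow_divides_pow_iff)
  then have "x = of_int y"
    using z assms(1) by simp
  then show ?thesis
    by simp
qed

lemma nat_of_nonneg_Ints:
  fixes x :: real
  assumes "x \<in> \<int>" "x \<ge> 0"
  obtains n where "x = real n"
  using assms by (metis Ints_cases of_int_0_le_iff of_nat_nat)

section \<open>Conjugation by matrices of determinant 1\<close>

lemma matrix_inv_SL2:
  fixes A :: "'a::field^2^2"
  assumes "det A = 1"
  shows "matrix_inv A = vector [vector [A$2$2, - A$1$2], vector [- A$2$1, A$1$1]]" (is "_ = ?B")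
proof -
  have "A ** ?B = mat 1"
    using assms
    by (simp add: vec_eq_iff forall_2 matrix_matrix_mult_def sum_2 mat_def det_2 algebra_simps)
  moreover from this have "?B ** A = mat 1"
    by (rule matrix_left_right_inverse[THEN iffD1])
  \<comment> \<open>\<open>matrix_inv\<close> is a choice term, so uniqueness of the inverse is what
    identifies it.\<close>
  moreover have "C = ?B" if "C ** A = mat 1" for C
  proof -
    have "C = C ** (A ** ?B)"
      by (simp only: \<open>A ** ?B = mat 1\<close> matrix_mul_rid)
    also have "\<dots> = ?B"
      by (simp only: matrix_mul_assoc that matrix_mul_lid)
    finally show ?thesis .
  qed
  ultimately show ?thesis
    unfolding matrix_inv_def by (intro some_equality) blast+
qed

lemma SL2_conjugate_nth:
  fixes A B :: "'a::field^2^2"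
  assumes "det A = 1"
  defines "C \<equiv> A ** B ** matrix_inv A"
  shows
    "C$1$1 = A$1$1 * A$2$2 * B$1$1 - A$1$1 * A$2$1 * B$1$2
       + A$1$2 * A$2$2 * B$2$1 - A$1$2 * A$2$1 * B$2$2"
    "C$1$2 = - (A$1$1 * A$1$2 * B$1$1) + (A$1$1)\<^sup>2 * B$1$2
       - (A$1$2)\<^sup>2 * B$2$1 + A$1$1 * A$1$2 * B$2$2"
    "C$2$1 = A$2$1 * A$2$2 * B$1$1 - (A$2$1)\<^sup>2 * B$1$2
       + (A$2$2)\<^sup>2 * B$2$1 - A$2$1 * A$2$2 * B$2$2"
  by (simp_all add: C_def matrix_inv_SL2[OF assms(1)] matrix_matrix_mult_def sum_2
      power2_eq_square algebra_simps)

text \<open>Turns the inclusion into integrality conditions that can be evaluated at explicit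
  matrices.\<close>

lemma conjugate_Gamma1_integrality:
  fixes A :: "real^2^2"
  assumes sub: "(\<lambda>B. A ** B ** matrix_inv A) ` (real_mat ` Gamma1 N) \<subseteq> real_mat ` Gamma0 N"
    and B: "B \<in> Gamma1 N" and "N > 0"
  defines "C \<equiv> A ** real_mat B ** matrix_inv A"
  shows "C$1$1 \<in> \<int>" "C$1$2 \<in> \<int>" "C$2$1 / real N \<in> \<int>"
proof -
  obtain D where D: "D \<in> Gamma0 N" "C = real_mat D"
    using sub B unfolding C_def by blast
  then obtain k where "D$2$1 = int N * k"
    by (auto simp: Gamma0_def)
  then show "C$1$1 \<in> \<int>" "C$1$2 \<in> \<int>" "C$2$1 / real N \<in> \<int>"
    using D \<open>N > 0\<close> by simp_all
qed

section \<open>From integrality of conjugates to the presentation of \<open>A\<close>\<close>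

theorem proposition2p3:
  fixes N :: nat and A :: "real^2^2"
  assumes "N > 0"
    and "A \<in> SL2R"
    and "(\<lambda>B. A ** B ** matrix_inv A) ` (real_mat ` Gamma1 N) \<subseteq> real_mat ` Gamma0 N"
  shows "A \<in> Gamma0_star N"
proof -
  define \<alpha> \<beta> \<gamma> \<delta> where entries: "\<alpha> = A$1$1" "\<beta> = A$1$2" "\<gamma> = A$2$1" "\<delta> = A$2$2"
  have detA: "det A = 1"
    using assms(2) by (simp add: SL2R_def)
  then have det: "\<alpha> * \<delta> - \<beta> * \<gamma> = 1"
    by (simp add: det_2 entries)
  note conj = conjugate_Gamma1_integrality[OF assms(3) _ assms(1),
      unfolded SL2_conjugate_nth[OF detA], folded entries, unfolded nth_map_matrix]
  \<comment> \<open>\<open>T\<close> and \<open>L\<close> give the squares of the entries of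
    \<open>A\<close>; \<open>P\<close> is the product \<open>T ** L\<close> and separates the
    remaining mixed products.\<close>
  define T L P :: "int^2^2" where
    "T = vector [vector [1, 1], vector [0, 1]]" and
    "L = vector [vector [1, 0], vector [int N, 1]]" and
    "P = vector [vector [1 + int N, 1], vector [int N, 1]]"
  have mem: "T \<in> Gamma1 N" "L \<in> Gamma1 N" "P \<in> Gamma1 N"
    by (auto simp: T_def L_def P_def Gamma1_def Gamma0_def det_2 cong_def)
  have T: "\<alpha> * \<gamma> \<in> \<int>" "\<alpha>\<^sup>2 \<in> \<int>" "\<gamma>\<^sup>2 / N \<in> \<int>"
  proof -
    have "\<alpha> * \<gamma> = 1 - (\<alpha> * \<delta> - \<alpha> * \<gamma> - \<beta> * \<gamma>)"
      using det by simp
    also have "\<dots> \<in> \<int>"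
      using conj(1)[OF mem(1)] by (intro Ints_diff[OF Ints_1]) (simp add: T_def)
    finally show "\<alpha> * \<gamma> \<in> \<int>" .
  qed (use conj(2,3)[OF mem(1)] in \<open>simp_all add: T_def\<close>)
  have L: "N * (\<beta> * \<delta>) \<in> \<int>" "N * \<beta>\<^sup>2 \<in> \<int>" "\<delta>\<^sup>2 \<in> \<int>"
  proof -
    have "N * (\<beta> * \<delta>) = (\<alpha> * \<delta> + \<beta> * \<delta> * N - \<beta> * \<gamma>) - 1"
      using det by simp
    also have "\<dots> \<in> \<int>"
      using conj(1)[OF mem(2)] by (intro Ints_diff[OF _ Ints_1]) (simp add: L_def)
    finally show "N * (\<beta> * \<delta>) \<in> \<int>" .
  qed (use conj(2,3)[OF mem(2)] \<open>N > 0\<close> in \<open>simp_all add: L_def mult_ac\<close>)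
  have P: "N * (\<alpha> * \<delta>) \<in> \<int>" "N * (\<alpha> * \<beta>) \<in> \<int>" "\<gamma> * \<delta> \<in> \<int>"
  proof -
    \<comment> \<open>In this and the next two equations the long parenthesis is an entry of the
      conjugate of \<open>P\<close>; the correction terms are integral by \<open>T\<close> and
      \<open>L\<close>.\<close>
    have "N * (\<alpha> * \<delta>) = (\<alpha> * \<delta> * (1 + N) - \<alpha> * \<gamma> + \<beta> * \<delta> * N - \<beta> * \<gamma>)
        - 1 + \<alpha> * \<gamma> - N * (\<beta> * \<delta>)"
      using det by (simp add: algebra_simps)
    also have "\<dots> \<in> \<int>"
      using conj(1)[OF mem(3)] T(1) L(1)
      by (intro Ints_diff[OF Ints_add[OF Ints_diff[OF _ Ints_1]]]) (simp_all add: P_def)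
    finally show "N * (\<alpha> * \<delta>) \<in> \<int>" .
    have "N * (\<alpha> * \<beta>) = \<alpha>\<^sup>2 - N * \<beta>\<^sup>2 - (- (\<alpha> * \<beta> * (1 + N)) + \<alpha>\<^sup>2 - \<beta>\<^sup>2 * N + \<alpha> * \<beta>)"
      by (simp add: algebra_simps)
    also have "\<dots> \<in> \<int>"
      using conj(2)[OF mem(3)] T(2) L(2)
      by (intro Ints_diff[OF Ints_diff]) (simp_all add: P_def)
    finally show "N * (\<alpha> * \<beta>) \<in> \<int>" .
    have "\<gamma> * \<delta> = (\<gamma> * \<delta> * (1 + N) - \<gamma>\<^sup>2 + \<delta>\<^sup>2 * N - \<gamma> * \<delta>) / N + \<gamma>\<^sup>2 / N - \<delta>\<^sup>2"
      using \<open>N > 0\<close> by (simp add: field_simps)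
    also have "\<dots> \<in> \<int>"
      using conj(3)[OF mem(3)] T(3) L(3)
      by (intro Ints_diff[OF Ints_add]) (simp_all add: P_def)
    finally show "\<gamma> * \<delta> \<in> \<int>" .
  qed
  obtain a where a: "\<alpha>\<^sup>2 = real a"
    using nat_of_nonneg_Ints[OF T(2)] by auto
  obtain b where b: "N * \<beta>\<^sup>2 = real b"
    using nat_of_nonneg_Ints[OF L(2)] by auto
  obtain c where c: "\<gamma>\<^sup>2 / N = real c"
    using nat_of_nonneg_Ints[OF T(3)] by auto
  obtain d where d: "\<delta>\<^sup>2 = real d"
    using nat_of_nonneg_Ints[OF L(3)] by auto
  have c': "\<gamma>\<^sup>2 = N * real c"
    using c \<open>N > 0\<close> by (simp add: field_simps)
  have ad_eq: "real (a * d) = (\<alpha> * \<delta>)\<^sup>2"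
    using a d by (simp add: power_mult_distrib)
  have bc_eq: "real (b * c) = (\<beta> * \<gamma>)\<^sup>2"
    using b[symmetric] c[symmetric] \<open>N > 0\<close> by (simp add: power_mult_distrib)
  have "\<alpha> * \<delta> \<in> \<int>"
    using Ints_if_square_and_multiple_Ints[OF \<open>N > 0\<close> P(1)] ad_eq
    by (metis Ints_of_nat)
  then obtain p where p: "\<alpha> * \<delta> = real_of_int p"
    by (auto elim: Ints_cases)
  have q: "\<beta> * \<gamma> = real_of_int (p - 1)"
    using det p by simp
  have "real_of_int (int (a * d)) = real_of_int (p\<^sup>2)"
    using ad_eq p by simp
  moreover have "real_of_int (int (b * c)) = real_of_int ((p - 1)\<^sup>2)"
    using bc_eq q by simp
  ultimately have "int (a * d) = p\<^sup>2" "int (b * c) = (p - 1)\<^sup>2"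
    by (simp_all only: of_int_eq_iff)
  \<comment> \<open>Consecutive integers are coprime, hence so are their squares.\<close>
  then have "coprime (int (a * d)) (int (b * c))"
    by (simp only: coprime_power_left_iff coprime_power_right_iff coprime_doff_one_right simp_thms)
  then have cop: "coprime (a * d) (b * c)"
    by (simp only: coprime_int_iff)
  \<comment> \<open>The roots are, up to sign, \<open>N * \<alpha> * \<beta>\<close>,
    \<open>\<alpha> * \<gamma>\<close>, \<open>N * \<beta> * \<delta>\<close>,
    \<open>\<gamma> * \<delta>\<close> and \<open>\<alpha> * \<delta>\<close>.\<close>
  have squares: "is_nth_power 2 (N * a * b)" "is_nth_power 2 (N * a * c)"
    "is_nth_power 2 (N * b * d)" "is_nth_power 2 (N * c * d)" "is_nth_power 2 (a * d)"
  proof -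
    show "is_nth_power 2 (N * a * b)"
      by (rule is_square_natI[OF P(2)])
        (simp add: a[symmetric] b[symmetric] power2_eq_square mult_ac)
    show "is_nth_power 2 (N * a * c)"
      by (rule is_square_natI[OF T(1)]) (simp add: power_mult_distrib c' a mult_ac)
    show "is_nth_power 2 (N * b * d)"
      by (rule is_square_natI[OF L(1)])
        (simp add: d[symmetric] b[symmetric] power2_eq_square mult_ac)
    show "is_nth_power 2 (N * c * d)"
      by (rule is_square_natI[OF P(3)]) (simp add: power_mult_distrib c' d)
    show "is_nth_power 2 (a * d)"
      by (rule is_square_natI[OF \<open>\<alpha> * \<delta> \<in> \<int>\<close> ad_eq])
  qed
  obtain u k l i j where u: "exact_divisor u N"
    and kl: "a = squarefree_part u * k\<^sup>2" "d = squarefree_part u * l\<^sup>2"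
    and ij: "b = squarefree_part (N div u) * i\<^sup>2" "c = squarefree_part (N div u) * j\<^sup>2"
    by (rule exact_divisor_of_square_products[OF \<open>N > 0\<close> squares cop])
  define v where "v = N div u"
  have N: "real N = real u * real v" and pos: "u > 0" "v > 0"
  proof -
    have "N = u * v"
      using u by (simp add: exact_divisor_def v_def)
    then show "real N = real u * real v" "u > 0" "v > 0"
      using \<open>N > 0\<close> by auto
  qed
  define s t s' t' where "s = square_part u" "t = squarefree_part u"
    "s' = square_part v" "t' = squarefree_part v"
  note st = this
  have uv: "real u = real t * (real s)\<^sup>2" "real v = real t' * (real s')\<^sup>2"
    using arg_cong[OF squarefree_decompose[of u], of real]
      arg_cong[OF squarefree_decompose[of v], of real]
    by (simp_all only: st of_nat_mult of_nat_power)
  have st_pos: "s > 0" "t > 0" "s' > 0" "t' > 0"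
    using pos by (auto simp: st intro!: Nat.gr0I)
  \<comment> \<open>The four coefficients come from solving the presentation with
    \<open>\<mu> = u\<close> for its parameters. Here the square of
    \<open>\<alpha> / sqrt u * s\<close> is \<open>a * s^2 / u = k^2\<close>, since
    \<open>a = t * k^2\<close> and \<open>u = t * s^2\<close>.\<close>
  have "\<alpha> / sqrt u \<in> frac_ints s"
    using st_pos pos kl uv
    by (intro frac_intsI[of _ _ k]) (simp_all add: power_mult_distrib power_divide a flip: st)
  moreover have "\<delta> / sqrt u \<in> frac_ints s"
    using st_pos pos kl uv
    by (intro frac_intsI[of _ _ l]) (simp_all add: power_mult_distrib power_divide d flip: st)
  moreover have "\<beta> * sqrt u \<in> frac_ints s'"
  proof (rule frac_intsI[of _ _ i])
    have "(\<beta> * sqrt u * s')\<^sup>2 = (N * \<beta>\<^sup>2) * s'\<^sup>2 / v"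
      using pos by (simp add: power_mult_distrib N)
    also have "\<dots> = (real i)\<^sup>2"
      using st_pos ij uv by (simp add: b flip: v_def st)
    finally show "(\<beta> * sqrt u * s')\<^sup>2 = (real i)\<^sup>2" .
  qed (use st_pos in auto)
  \<comment> \<open>Since \<open>\<gamma>^2 = N * c\<close> and \<open>N = u * v\<close>, one factor
    \<open>v\<close> survives in the denominator and cancels against
    \<open>c * s'^2 = v * j^2\<close>.\<close>
  moreover have "\<gamma> / (v * sqrt u) \<in> frac_ints s'"
  proof (rule frac_intsI[of _ _ j])
    have "(\<gamma> / (v * sqrt u) * s')\<^sup>2 = real c * s'\<^sup>2 / v"
      using pos by (simp add: power_mult_distrib power_divide c' N) (simp add: power2_eq_square)
    also have "\<dots> = (real j)\<^sup>2"
      using st_pos ij uv by (simp flip: v_def st)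
    finally show "(\<gamma> / (v * sqrt u) * s')\<^sup>2 = (real j)\<^sup>2" .
  qed (use st_pos in auto)
  moreover have "A = vector
      [vector [\<alpha> / sqrt u * sqrt u, \<beta> * sqrt u / sqrt u],
       vector [\<gamma> / (v * sqrt u) * real v * sqrt u, \<delta> / sqrt u * sqrt u]]"
    using pos by (simp add: vec_eq_iff forall_2 entries)
  ultimately show ?thesis
    using assms(2) u unfolding Gamma0_star_def st v_def by blast
qed

end
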